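(* The space $(\mathcal{P}_0,d^W)$ has vanishing Alexandrov curvature in the following sense. Let $\mu,\nu,\eta\in\mathcal{P}_0$ be the vertices of a geodesic triangle in $(\mathcal{P}_0,d^W)$, let $\gamma_{\nu\eta}$ be its side joining $\nu$ and $\eta$, and let $\overline p,\overline q,\overline r\in\mathbb{R}^2$ be the vertices of a comparison triangle, i.e. $|\overline p\,\overline q|=d^W(\mu,\nu)$, $|\overline p\,\overline r|=d^W(\mu,\eta)$, $|\overline q\,\overline r|=d^W(\nu,\eta)$. For any point $x$ on $\gamma_{\nu\eta}$, let $\overline x$ be the point of the segment $\overline q\,\overline r$ with $|\overline q\,\overline x|=d^W(\nu,x)$ and $|\overline x\,\overline r|=d^W(x,\eta)$. Then $$d^W(\mu,x)=|\overline p\,\overline x|.$$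
   Context: $\mathcal{P}_0=\mathcal{P}([0,1])$ is the set of Borel probability measures on $[0,1]$, equipped with the ($2$-)Wasserstein distance $$d^W(\mu,\nu)^2=\inf_{\pi\in\Pi(\mu,\nu)}\int_{[0,1]\times[0,1]}|x-y|^2\,d\pi(x,y),$$ where $\Pi(\mu,\nu)$ is the set of Borel probability measures on $[0,1]\times[0,1]$ with first marginal $\mu$ and second marginal $\nu$. A geodesic in a metric space $(X,d)$ is a continuous curve whose length equals the distance between its endpoints; it is parametrized as $\gamma:[0,1]\to X$ with $d(\gamma(t),\gamma(t'))=|t-t'|\,d(\gamma(0),\gamma(1))$. A geodesic triangle consists of three points together with a geodesic between each pair of them. $|\overline a\,\overline b|$ denotes Euclidean distance in $\mathbb{R}^2$. *)

theory Defs
  imports "HOL-Probability.Probability"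
begin

definition borel_probs :: "'a::topological_space set \<Rightarrow> 'a measure set" where
  "borel_probs S = {M. prob_space M \<and> sets M = sets (restrict_space borel S)}"

abbreviation P0 :: "real measure set" where
  "P0 \<equiv> borel_probs {0..1}"

definition couplings :: "real measure \<Rightarrow> real measure \<Rightarrow> (real \<times> real) measure set" where
  "couplings \<mu> \<nu> = {\<pi> \<in> borel_probs ({0..1} \<times> {0..1}).
     distr \<pi> (restrict_space borel {0..1}) fst = \<mu> \<and>
     distr \<pi> (restrict_space borel {0..1}) snd = \<nu>}"

(* Meaningful for measures in P0 only: there the set of couplings contains the product
   measure and the cost takes values in [0,1], so neither the real-valued Inf nor the
   Bochner integral is a default value. *)
definition dW :: "real measure \<Rightarrow> real measure \<Rightarrow> real" where
  "dW \<mu> \<nu> = sqrt (INF \<pi>\<in>couplings \<mu> \<nu>. \<integral>z. \<bar>fst z - snd z\<bar>\<^sup>2 \<partial>\<pi>)"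

(* Geodesics are parametrized proportionally to arc length on [0,1]; for a metric d the
   last conjunct implies that the curve is continuous with length d x y. *)
definition geodesic_between ::
  "'a set \<Rightarrow> ('a \<Rightarrow> 'a \<Rightarrow> real) \<Rightarrow> (real \<Rightarrow> 'a) \<Rightarrow> 'a \<Rightarrow> 'a \<Rightarrow> bool" where
  "geodesic_between X d \<gamma> x y \<longleftrightarrow>
     \<gamma> \<in> {0..1} \<rightarrow> X \<and> \<gamma> 0 = x \<and> \<gamma> 1 = y \<and>
     (\<forall>t\<in>{0..1}. \<forall>t'\<in>{0..1}. d (\<gamma> t) (\<gamma> t') = \<bar>t - t'\<bar> * d (\<gamma> 0) (\<gamma> 1))"

definition geodesic_triangle ::
  "'a set \<Rightarrow> ('a \<Rightarrow> 'a \<Rightarrow> real) \<Rightarrow> 'a \<Rightarrow> 'a \<Rightarrow> 'a \<Rightarrow>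
   (real \<Rightarrow> 'a) \<Rightarrow> (real \<Rightarrow> 'a) \<Rightarrow> (real \<Rightarrow> 'a) \<Rightarrow> bool" where
  "geodesic_triangle X d a b c \<gamma>ab \<gamma>ac \<gamma>bc \<longleftrightarrow>
     a \<in> X \<and> b \<in> X \<and> c \<in> X \<and>
     geodesic_between X d \<gamma>ab a b \<and>
     geodesic_between X d \<gamma>ac a c \<and>
     geodesic_between X d \<gamma>bc b c"

end

theory Submission
  imports Defs
begin

text \<open>On the line the monotone coupling is optimal, so the quantile map embeds \<open>P0\<close> isometrically
  into \<open>L\<^sup>2(0,1)\<close>. Distances from a fixed point to the points of a geodesic are therefore given by
  the same Stewart identity as in the plane, and agree with those in the comparison triangle.\<close>

section \<open>Product moments, and the extremality of comonotone pairs\<close>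

text \<open>A nonnegative number \<open>c\<close> is the length of the set of \<open>s\<close> with
  \<open>0 \<le> s < c\<close>. Writing both factors this way and applying Tonelli leaves the
  measure of a quadrant event. The condition \<open>0 \<le> s\<close> sits inside the event, so that
  the outer integrals can run over the whole line.\<close>

lemma nn_integral_mult_layer_cake:
  fixes X Y :: "'a \<Rightarrow> real"
  assumes "sigma_finite_measure M"
    and [measurable]: "X \<in> borel_measurable M" "Y \<in> borel_measurable M"
    and nonneg: "\<And>z. z \<in> space M \<Longrightarrow> 0 \<le> X z" "\<And>z. z \<in> space M \<Longrightarrow> 0 \<le> Y z"
  shows "(\<integral>\<^sup>+z. ennreal (X z * Y z) \<partial>M) =
    (\<integral>\<^sup>+s. \<integral>\<^sup>+t. emeasure M {z \<in> space M. (0 \<le> s \<and> s < X z) \<and> 0 \<le> t \<and> t < Y z} \<partial>lborel \<partial>lborel)"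
proof -
  interpret sigma_finite_measure M by fact
  interpret pair_sigma_finite lborel M
    by unfold_locales
  define f :: "'a \<Rightarrow> real \<Rightarrow> ennreal" where "f z s = of_bool (0 \<le> s \<and> s < X z)" for z s
  define g :: "'a \<Rightarrow> real \<Rightarrow> ennreal" where "g z t = of_bool (0 \<le> t \<and> t < Y z)" for z t
  have layer: "(\<integral>\<^sup>+s. of_bool (0 \<le> s \<and> s < c) \<partial>lborel) = ennreal c" if "0 \<le> c" for c :: real
  proof -
    have "(\<integral>\<^sup>+s. of_bool (0 \<le> s \<and> s < c) \<partial>lborel) = (\<integral>\<^sup>+s. indicator {0..<c} s \<partial>lborel)"
      by (intro nn_integral_cong) (auto simp: indicator_def)
    then show ?thesis
      using that by simp
  qed
  have [measurable]: "(\<lambda>(z, s). f z s) \<in> borel_measurable (M \<Otimes>\<^sub>M lborel)"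
    "(\<lambda>(z, s). g z s) \<in> borel_measurable (M \<Otimes>\<^sub>M lborel)"
    unfolding f_def g_def by measurable
  have "(\<integral>\<^sup>+z. ennreal (X z * Y z) \<partial>M) = (\<integral>\<^sup>+z. \<integral>\<^sup>+s. f z s * (\<integral>\<^sup>+t. g z t \<partial>lborel) \<partial>lborel \<partial>M)"
  proof (intro nn_integral_cong)
    fix z assume z: "z \<in> space M"
    have "(\<integral>\<^sup>+s. f z s * (\<integral>\<^sup>+t. g z t \<partial>lborel) \<partial>lborel) = (\<integral>\<^sup>+s. f z s \<partial>lborel) * (\<integral>\<^sup>+t. g z t \<partial>lborel)"
      using z by (intro nn_integral_multc) measurable
    then show "ennreal (X z * Y z) = (\<integral>\<^sup>+s. f z s * (\<integral>\<^sup>+t. g z t \<partial>lborel) \<partial>lborel)"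
      using nonneg[OF z] by (simp add: f_def g_def layer ennreal_mult)
  qed
  also have "\<dots> = (\<integral>\<^sup>+z. \<integral>\<^sup>+s. \<integral>\<^sup>+t. f z s * g z t \<partial>lborel \<partial>lborel \<partial>M)"
    by (intro nn_integral_cong nn_integral_cmult[symmetric]) measurable
  \<comment> \<open>The integral over \<open>z\<close> is moved inwards in two swaps, first past
    \<open>s\<close> and then, for fixed \<open>s\<close>, past \<open>t\<close>.\<close>
  also have "\<dots> = (\<integral>\<^sup>+s. \<integral>\<^sup>+z. \<integral>\<^sup>+t. f z s * g z t \<partial>lborel \<partial>M \<partial>lborel)"
    by (intro Fubini') measurable
  also have "\<dots> = (\<integral>\<^sup>+s. \<integral>\<^sup>+t. \<integral>\<^sup>+z. f z s * g z t \<partial>M \<partial>lborel \<partial>lborel)"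
    by (intro nn_integral_cong Fubini') measurable
  also have "\<dots> = (\<integral>\<^sup>+s. \<integral>\<^sup>+t. emeasure M {z \<in> space M. (0 \<le> s \<and> s < X z) \<and> 0 \<le> t \<and> t < Y z} \<partial>lborel \<partial>lborel)"
  proof (intro nn_integral_cong)
    fix s t
    have "(\<integral>\<^sup>+z. f z s * g z t \<partial>M) =
        (\<integral>\<^sup>+z. indicator {z \<in> space M. (0 \<le> s \<and> s < X z) \<and> 0 \<le> t \<and> t < Y z} z \<partial>M)"
      by (intro nn_integral_cong) (auto simp: indicator_def f_def g_def)
    then show "(\<integral>\<^sup>+z. f z s * g z t \<partial>M) =
        emeasure M {z \<in> space M. (0 \<le> s \<and> s < X z) \<and> 0 \<le> t \<and> t < Y z}"
      by simp
  qed
  finally show ?thesis .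
qed

text \<open>The two second moments depend only on the marginal laws, so minimising the mean squared
  difference amounts to maximising the mixed moment.\<close>

lemma expectation_sq_diff:
  fixes X Y :: "'a \<Rightarrow> real"
  assumes "prob_space M"
    and [measurable]: "X \<in> borel_measurable M" "Y \<in> borel_measurable M"
    and unit: "\<And>z. z \<in> space M \<Longrightarrow> X z \<in> {0..1}" "\<And>z. z \<in> space M \<Longrightarrow> Y z \<in> {0..1}"
  shows "(\<integral>z. (X z - Y z)\<^sup>2 \<partial>M) = (\<integral>z. (X z)\<^sup>2 \<partial>M) + (\<integral>z. (Y z)\<^sup>2 \<partial>M) - 2 * (\<integral>z. X z * Y z \<partial>M)"
proof -
  interpret prob_space M by fact
  have "integrable M (\<lambda>z. (X z)\<^sup>2)" "integrable M (\<lambda>z. (Y z)\<^sup>2)" "integrable M (\<lambda>z. X z * Y z)"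
    using unit by (auto intro!: integrable_const_bound[where B=1] AE_I2 mult_le_one simp: abs_mult power_le_one)
  then show ?thesis
    by (simp add: power2_diff mult.assoc)
qed

text \<open>Hoeffding: among the pairs with given marginal laws, the product moment is the integral of
  the quadrant probabilities, and these are largest when the superlevel sets are nested.\<close>

lemma comonotone_minimises_sq_diff:
  fixes X Y :: "'a \<Rightarrow> real" and X' Y' :: "'b \<Rightarrow> real"
  assumes M: "prob_space M" and N: "prob_space N"
    and meas [measurable]: "X \<in> borel_measurable M" "Y \<in> borel_measurable M"
      "X' \<in> borel_measurable N" "Y' \<in> borel_measurable N"
    and unit: "\<And>z. z \<in> space M \<Longrightarrow> X z \<in> {0..1}" "\<And>z. z \<in> space M \<Longrightarrow> Y z \<in> {0..1}"
    and unit': "\<And>u. u \<in> space N \<Longrightarrow> X' u \<in> {0..1}" "\<And>u. u \<in> space N \<Longrightarrow> Y' u \<in> {0..1}"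
    and law_X: "distr N borel X' = distr M borel X"
    and law_Y: "distr N borel Y' = distr M borel Y"
    and nested: "\<And>s t. (\<forall>u\<in>space N. s < X' u \<longrightarrow> t < Y' u) \<or> (\<forall>u\<in>space N. t < Y' u \<longrightarrow> s < X' u)"
  shows "(\<integral>u. (X' u - Y' u)\<^sup>2 \<partial>N) \<le> (\<integral>z. (X z - Y z)\<^sup>2 \<partial>M)"
proof -
  interpret M: prob_space M by fact
  interpret N: prob_space N by fact
  have tail_X: "emeasure N {u \<in> space N. s < X' u} = emeasure M {z \<in> space M. s < X z}" for s
    using arg_cong[OF law_X, of "\<lambda>L. emeasure L {s<..}"]
    by (simp add: emeasure_distr vimage_def Int_def conj_commute)
  have tail_Y: "emeasure N {u \<in> space N. t < Y' u} = emeasure M {z \<in> space M. t < Y z}" for t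
    using arg_cong[OF law_Y, of "\<lambda>L. emeasure L {t<..}"]
    by (simp add: emeasure_distr vimage_def Int_def conj_commute)
  \<comment> \<open>By nestedness the quadrant event for \<open>N\<close> is one of the two
    superlevel sets. Its measure is the corresponding tail under \<open>M\<close>, which contains
    the quadrant event for \<open>M\<close>. If \<open>s\<close> or \<open>t\<close> is negative,
    both events are empty.\<close>
  have quadrant: "emeasure M {z \<in> space M. (0 \<le> s \<and> s < X z) \<and> 0 \<le> t \<and> t < Y z} \<le>
      emeasure N {u \<in> space N. (0 \<le> s \<and> s < X' u) \<and> 0 \<le> t \<and> t < Y' u}" for s t
  proof (cases "0 \<le> s \<and> 0 \<le> t")
    case True
    from nested[of s t] show ?thesis
    proof
      assume "\<forall>u\<in>space N. s < X' u \<longrightarrow> t < Y' u"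
      then have "{u \<in> space N. (0 \<le> s \<and> s < X' u) \<and> 0 \<le> t \<and> t < Y' u} = {u \<in> space N. s < X' u}"
        using True by auto
      then show ?thesis
        by (auto simp: tail_X intro!: emeasure_mono)
    next
      assume "\<forall>u\<in>space N. t < Y' u \<longrightarrow> s < X' u"
      then have "{u \<in> space N. (0 \<le> s \<and> s < X' u) \<and> 0 \<le> t \<and> t < Y' u} = {u \<in> space N. t < Y' u}"
        using True by auto
      then show ?thesis
        by (auto simp: tail_Y intro!: emeasure_mono)
    qed
  qed (auto simp: not_le)
  have "(\<integral>\<^sup>+z. ennreal (X z * Y z) \<partial>M) \<le> (\<integral>\<^sup>+u. ennreal (X' u * Y' u) \<partial>N)"
    using unit unit' quadrant
    by (subst (1 2) nn_integral_mult_layer_cake)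
       (auto intro!: nn_integral_mono M.sigma_finite_measure_axioms N.sigma_finite_measure_axioms)
  moreover have "(\<integral>\<^sup>+z. ennreal (X z * Y z) \<partial>M) = ennreal (\<integral>z. X z * Y z \<partial>M)"
    using unit by (intro nn_integral_eq_integral M.integrable_const_bound[where B=1] AE_I2)
      (auto intro: mult_le_one simp: abs_mult)
  moreover have "(\<integral>\<^sup>+u. ennreal (X' u * Y' u) \<partial>N) = ennreal (\<integral>u. X' u * Y' u \<partial>N)"
    using unit' by (intro nn_integral_eq_integral N.integrable_const_bound[where B=1] AE_I2)
      (auto intro: mult_le_one simp: abs_mult)
  \<comment> \<open>\<open>ennreal\<close> truncates at 0, so the inequality descends to the reals
    only once the larger side is known to be nonnegative.\<close>
  moreover have "0 \<le> (\<integral>u. X' u * Y' u \<partial>N)"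
    using unit' by (intro Bochner_Integration.integral_nonneg_AE AE_I2) auto
  ultimately have "(\<integral>z. X z * Y z \<partial>M) \<le> (\<integral>u. X' u * Y' u \<partial>N)"
    by simp
  moreover have "(\<integral>u. (X' u)\<^sup>2 \<partial>N) = (\<integral>z. (X z)\<^sup>2 \<partial>M)"
    using arg_cong[OF law_X, of "\<lambda>L. \<integral>x. x\<^sup>2 \<partial>L"] by (simp add: integral_distr)
  moreover have "(\<integral>u. (Y' u)\<^sup>2 \<partial>N) = (\<integral>z. (Y z)\<^sup>2 \<partial>M)"
    using arg_cong[OF law_Y, of "\<lambda>L. \<integral>x. x\<^sup>2 \<partial>L"] by (simp add: integral_distr)
  ultimately show ?thesis
    using expectation_sq_diff[OF M meas(1,2) unit] expectation_sq_diff[OF N meas(3,4) unit'] by simp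
qed

section \<open>Quantile functions of measures on the unit interval\<close>

text \<open>The generalised inverse of the distribution function. Measures in \<open>P0\<close> live
  on a restricted space, so they are first pushed to \<open>borel\<close> along the identity to have
  a \<open>cdf\<close> on the whole line. The infimum is used for \<open>u\<close> strictly between
  0 and 1, where the set is nonempty and bounded below.\<close>

definition quantile :: "real measure \<Rightarrow> real \<Rightarrow> real" where
  "quantile \<mu> u = Inf {y. u \<le> cdf (distr \<mu> borel (\<lambda>y. y)) y}"

abbreviation unit_lebesgue :: "real measure" where
  "unit_lebesgue \<equiv> restrict_space lborel {0<..<1}"

lemma space_unit_lebesgue [simp]: "space unit_lebesgue = {0<..<1}"
  by (simp add: space_restrict_space)

lemma prob_space_unit_lebesgue: "prob_space unit_lebesgue"
  by (auto simp: space_restrict_space emeasure_restrict_space intro!: prob_spaceI)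

lemma borel_probs_space:
  "\<mu> \<in> borel_probs S \<Longrightarrow> space \<mu> = S"
  using sets_eq_imp_space_eq[of \<mu> "restrict_space borel S"]
  by (auto simp: borel_probs_def space_restrict_space)

lemma borel_probs_measurable:
  assumes "\<mu> \<in> borel_probs S" "f \<in> measurable borel N"
  shows "f \<in> measurable \<mu> N"
proof -
  have "sets \<mu> = sets (restrict_space borel S)"
    using assms(1) by (simp add: borel_probs_def)
  then show ?thesis
    using measurable_restrict_space1[OF assms(2)] measurable_cong_sets by blast
qed

text \<open>Opens the locale that constructs the generalised inverse \<open>I\<close>; the next
  three lemmas transfer its order property, measurability and law to
  \<open>quantile\<close>.\<close>

lemma P0_cdf_distribution:
  assumes "\<mu> \<in> P0"
  shows "cdf_distribution (distr \<mu> borel (\<lambda>y. y))"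
proof -
  interpret prob_space \<mu>
    using assms by (simp add: borel_probs_def)
  show ?thesis
    unfolding cdf_distribution_def
    by (intro real_distribution_distr borel_probs_measurable[OF assms]) simp
qed

text \<open>The negated Galois connection between a distribution function and its inverse;
  right-continuity makes it exact. Superlevel sets of a quantile function are therefore rays in
  \<open>u\<close>, which is the source of comonotonicity.\<close>

lemma quantile_less_iff:
  assumes "\<mu> \<in> P0" "u \<in> {0<..<1}"
  shows "y < quantile \<mu> u \<longleftrightarrow> cdf (distr \<mu> borel (\<lambda>y. y)) y < u"
proof -
  interpret cdf_distribution "distr \<mu> borel (\<lambda>y. y)"
    using assms(1) by (rule P0_cdf_distribution)
  show ?thesis
    using pseudoinverse[of u y] assms(2) by (auto simp: quantile_def not_le[symmetric])
qed

lemma quantile_measurable: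
  assumes "\<mu> \<in> P0"
  shows "quantile \<mu> \<in> borel_measurable unit_lebesgue"
proof -
  interpret cdf_distribution "distr \<mu> borel (\<lambda>y. y)"
    using assms by (rule P0_cdf_distribution)
  have "I \<in> borel_measurable unit_lebesgue"
    using measurable_CI by (simp add: measurable_def space_restrict_space sets_restrict_space)
  then show ?thesis
    by (simp add: quantile_def[abs_def])
qed

lemma distr_quantile_borel:
  assumes "\<mu> \<in> P0"
  shows "distr unit_lebesgue borel (quantile \<mu>) = distr \<mu> borel (\<lambda>y. y)"
proof -
  interpret cdf_distribution "distr \<mu> borel (\<lambda>y. y)"
    using assms by (rule P0_cdf_distribution)
  show ?thesis
    using distr_I_eq_M by (simp add: quantile_def[abs_def])
qed

text \<open>The distribution function is 1 at the point 1 and 0 at every negative point, so a level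
  strictly between 0 and 1 is first reached inside the unit interval.\<close>

lemma quantile_unit:
  assumes \<mu>: "\<mu> \<in> P0" and u: "u \<in> {0<..<1}"
  shows "quantile \<mu> u \<in> {0..1}"
proof -
  interpret prob_space \<mu>
    using \<mu> by (simp add: borel_probs_def)
  have [simp]: "space \<mu> = {0..1}"
    using \<mu> by (rule borel_probs_space)
  have cdf: "cdf (distr \<mu> borel (\<lambda>y. y)) y = prob ({..y} \<inter> {0..1})" for y
    using borel_probs_measurable[OF \<mu>, of "\<lambda>y. y" borel] by (simp add: cdf_def measure_distr)
  have "{..1} \<inter> {0..1} = space \<mu>"
    by auto
  then have "\<not> 1 < quantile \<mu> u"
    using u by (simp only: quantile_less_iff[OF \<mu> u] cdf prob_space) simp
  moreover have "y < quantile \<mu> u" if "y < 0" for y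
  proof -
    have "{..y} \<inter> {0..1} = {}"
      using that by auto
    then show ?thesis
      unfolding quantile_less_iff[OF \<mu> u] cdf using u by (simp only: measure_empty) simp
  qed
  then have "0 \<le> quantile \<mu> u"
    by (meson dense_le less_imp_le)
  ultimately show ?thesis
    by simp
qed

text \<open>Sharpens the equality of laws on the line to an equality of measures on the restricted
  space, the form in which \<open>couplings\<close> states its marginal conditions.\<close>

lemma distr_quantile:
  assumes \<mu>: "\<mu> \<in> P0"
  shows "distr unit_lebesgue (restrict_space borel {0..1}) (quantile \<mu>) = \<mu>"
proof (rule measure_eqI)
  show sets_eq: "sets (distr unit_lebesgue (restrict_space borel {0..1}) (quantile \<mu>)) = sets \<mu>"
    using \<mu> by (simp add: borel_probs_def)
  fix A assume "A \<in> sets (distr unit_lebesgue (restrict_space borel {0..1}) (quantile \<mu>))"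
  then have A: "A \<in> sets (restrict_space borel {0..1})"
    by simp
  then have A_borel: "A \<in> sets borel" and A_unit: "A \<subseteq> {0..1}"
    by (auto simp: sets_restrict_space)
  have "quantile \<mu> \<in> measurable unit_lebesgue (restrict_space borel {0..1})"
    using quantile_unit[OF \<mu>] by (intro measurable_restrict_space2 quantile_measurable[OF \<mu>]) auto
  then have "emeasure (distr unit_lebesgue (restrict_space borel {0..1}) (quantile \<mu>)) A =
      emeasure (distr unit_lebesgue borel (quantile \<mu>)) A"
    using A A_borel by (simp add: emeasure_distr quantile_measurable[OF \<mu>])
  also have "\<dots> = emeasure \<mu> A"
    using A_borel A_unit borel_probs_space[OF \<mu>]
    by (simp add: distr_quantile_borel[OF \<mu>] emeasure_distr borel_probs_measurable[OF \<mu>] Int_absorb2)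
  finally show "emeasure (distr unit_lebesgue (restrict_space borel {0..1}) (quantile \<mu>)) A = emeasure \<mu> A" .
qed

section \<open>Optimality of the monotone coupling, and the isometry into L2\<close>

text \<open>Both quantile functions are driven by the same uniform variable \<open>u\<close>. The
  marginals come from \<open>distr_quantile\<close>, and a change of variables turns the cost into a
  squared L2 distance.\<close>

lemma quantile_coupling:
  assumes \<mu>: "\<mu> \<in> P0" and \<nu>: "\<nu> \<in> P0"
  defines "\<pi> \<equiv> distr unit_lebesgue (restrict_space borel ({0..1} \<times> {0..1})) (\<lambda>u. (quantile \<mu> u, quantile \<nu> u))"
  shows "\<pi> \<in> couplings \<mu> \<nu>"
    and "(\<integral>z. \<bar>fst z - snd z\<bar>\<^sup>2 \<partial>\<pi>) = (\<integral>u. (quantile \<mu> u - quantile \<nu> u)\<^sup>2 \<partial>unit_lebesgue)"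
proof -
  interpret prob_space unit_lebesgue
    by (rule prob_space_unit_lebesgue)
  note [measurable] = quantile_measurable[OF \<mu>] quantile_measurable[OF \<nu>]
  have pair: "(\<lambda>u. (quantile \<mu> u, quantile \<nu> u)) \<in>
      measurable unit_lebesgue (restrict_space borel ({0..1} \<times> {0..1}))"
    using quantile_unit[OF \<mu>] quantile_unit[OF \<nu>]
    by (intro measurable_restrict_space2) (auto simp: borel_prod[symmetric])
  have "fst \<in> measurable (restrict_space borel ({0..1::real} \<times> {0..1::real})) (restrict_space borel {0..1::real})"
    by (intro measurable_restrict_space2 measurable_restrict_space1)
       (auto simp: space_restrict_space borel_prod[symmetric])
  moreover have "snd \<in> measurable (restrict_space borel ({0..1::real} \<times> {0..1::real})) (restrict_space borel {0..1::real})"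
    by (intro measurable_restrict_space2 measurable_restrict_space1)
       (auto simp: space_restrict_space borel_prod[symmetric])
  ultimately show "\<pi> \<in> couplings \<mu> \<nu>"
    using pair prob_space_distr[OF pair] distr_quantile[OF \<mu>] distr_quantile[OF \<nu>]
    by (simp add: couplings_def borel_probs_def \<pi>_def distr_distr comp_def)
  show "(\<integral>z. \<bar>fst z - snd z\<bar>\<^sup>2 \<partial>\<pi>) = (\<integral>u. (quantile \<mu> u - quantile \<nu> u)\<^sup>2 \<partial>unit_lebesgue)"
    unfolding \<pi>_def
    by (subst integral_distr[OF pair])
       (auto intro!: measurable_restrict_space1 simp: borel_prod[symmetric])
qed

text \<open>The two coordinates under \<pi> have the same laws as the two quantile functions, and
  the latter form a comonotone pair, so \<open>comonotone_minimises_sq_diff\<close> applies.\<close>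

lemma coupling_cost_ge:
  assumes \<mu>: "\<mu> \<in> P0" and \<nu>: "\<nu> \<in> P0" and \<pi>: "\<pi> \<in> couplings \<mu> \<nu>"
  shows "(\<integral>u. (quantile \<mu> u - quantile \<nu> u)\<^sup>2 \<partial>unit_lebesgue) \<le> (\<integral>z. \<bar>fst z - snd z\<bar>\<^sup>2 \<partial>\<pi>)"
proof -
  have \<pi>_probs: "\<pi> \<in> borel_probs ({0..1} \<times> {0..1})"
    and fst_law: "distr \<pi> (restrict_space borel {0..1}) fst = \<mu>"
    and snd_law: "distr \<pi> (restrict_space borel {0..1}) snd = \<nu>"
    using \<pi> by (auto simp: couplings_def)
  have space: "space \<pi> = {0..1} \<times> {0..1}"
    using \<pi>_probs by (rule borel_probs_space)
  have fst: "fst \<in> borel_measurable \<pi>" and snd: "snd \<in> borel_measurable \<pi>"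
    by (auto intro!: borel_probs_measurable[OF \<pi>_probs] simp: borel_prod[symmetric])
  have "fst \<in> measurable \<pi> (restrict_space borel {0..1})" "snd \<in> measurable \<pi> (restrict_space borel {0..1})"
    by (intro measurable_restrict_space2 fst snd; auto simp: space)+
  \<comment> \<open>The marginals are pushed from the restricted space to the line, where
    \<open>distr_quantile_borel\<close> describes the laws of the quantile functions.\<close>
  then have "distr (distr \<pi> (restrict_space borel {0..1}) fst) borel (\<lambda>y. y) = distr \<pi> borel fst"
    and "distr (distr \<pi> (restrict_space borel {0..1}) snd) borel (\<lambda>y. y) = distr \<pi> borel snd"
    by (simp_all add: distr_distr measurable_restrict_space1 comp_def)
  then have laws: "distr unit_lebesgue borel (quantile \<mu>) = distr \<pi> borel fst"
    "distr unit_lebesgue borel (quantile \<nu>) = distr \<pi> borel snd"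
    by (simp_all add: distr_quantile_borel \<mu> \<nu> fst_law snd_law)
  have "(\<integral>u. (quantile \<mu> u - quantile \<nu> u)\<^sup>2 \<partial>unit_lebesgue) \<le> (\<integral>z. (fst z - snd z)\<^sup>2 \<partial>\<pi>)"
  proof (rule comonotone_minimises_sq_diff)
    \<comment> \<open>The two superlevel sets are the rays of all \<open>u\<close> above the value
      of one \<open>cdf\<close> at \<open>s\<close> and of the other at \<open>t\<close>; the ray
      with the larger endpoint lies in the other.\<close>
    fix s t
    show "(\<forall>u\<in>space unit_lebesgue. s < quantile \<mu> u \<longrightarrow> t < quantile \<nu> u) \<or>
        (\<forall>u\<in>space unit_lebesgue. t < quantile \<nu> u \<longrightarrow> s < quantile \<mu> u)"
      by (cases "cdf (distr \<nu> borel (\<lambda>y. y)) t \<le> cdf (distr \<mu> borel (\<lambda>y. y)) s")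
         (auto simp: quantile_less_iff \<mu> \<nu>)
  qed (use \<pi>_probs space quantile_unit[OF \<mu>] quantile_unit[OF \<nu>] in
      \<open>auto simp: borel_probs_def laws fst snd quantile_measurable[OF \<mu>] quantile_measurable[OF \<nu>] prob_space_unit_lebesgue\<close>)
  then show ?thesis
    by simp
qed

text \<open>The infimum is a minimum, attained at the quantile coupling. Nonnegativity is recorded
  because later arguments compare squares.\<close>

lemma dW_quantile:
  assumes "\<mu> \<in> P0" "\<nu> \<in> P0"
  shows "(dW \<mu> \<nu>)\<^sup>2 = (\<integral>u. (quantile \<mu> u - quantile \<nu> u)\<^sup>2 \<partial>unit_lebesgue)"
    and "0 \<le> dW \<mu> \<nu>"
proof -
  have "(INF \<pi>\<in>couplings \<mu> \<nu>. \<integral>z. \<bar>fst z - snd z\<bar>\<^sup>2 \<partial>\<pi>) =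
      (\<integral>u. (quantile \<mu> u - quantile \<nu> u)\<^sup>2 \<partial>unit_lebesgue)"
    using quantile_coupling[OF assms] coupling_cost_ge[OF assms]
    by (intro cInf_eq_minimum) (auto intro!: image_eqI)
  then show "(dW \<mu> \<nu>)\<^sup>2 = (\<integral>u. (quantile \<mu> u - quantile \<nu> u)\<^sup>2 \<partial>unit_lebesgue)" "0 \<le> dW \<mu> \<nu>"
    by (auto simp: dW_def)
qed

section \<open>Stewart's identity for squared distances\<close>

text \<open>The hypotheses on \<open>f\<close> force it to equal \<open>(1 - t) a + t b\<close> almost everywhere.\<close>

lemma stewart_L2:
  fixes a b f m :: "'a \<Rightarrow> real"
  assumes "prob_space M"
    and meas [measurable]: "a \<in> borel_measurable M" "b \<in> borel_measurable M"
      "f \<in> borel_measurable M" "m \<in> borel_measurable M"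
    and unit: "\<And>u. u \<in> space M \<Longrightarrow> a u \<in> {0..1}" "\<And>u. u \<in> space M \<Longrightarrow> b u \<in> {0..1}"
      "\<And>u. u \<in> space M \<Longrightarrow> f u \<in> {0..1}" "\<And>u. u \<in> space M \<Longrightarrow> m u \<in> {0..1}"
    and af: "(\<integral>u. (a u - f u)\<^sup>2 \<partial>M) = t\<^sup>2 * (\<integral>u. (a u - b u)\<^sup>2 \<partial>M)"
    and fb: "(\<integral>u. (f u - b u)\<^sup>2 \<partial>M) = (1 - t)\<^sup>2 * (\<integral>u. (a u - b u)\<^sup>2 \<partial>M)"
  shows "(\<integral>u. (m u - f u)\<^sup>2 \<partial>M) = (1 - t) * (\<integral>u. (m u - a u)\<^sup>2 \<partial>M) + t * (\<integral>u. (m u - b u)\<^sup>2 \<partial>M)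
    - t * (1 - t) * (\<integral>u. (a u - b u)\<^sup>2 \<partial>M)"
proof -
  interpret prob_space M by fact
  have int: "integrable M (\<lambda>u. (g u - h u)\<^sup>2)"
    if [measurable]: "g \<in> borel_measurable M" "h \<in> borel_measurable M"
      and "\<And>u. u \<in> space M \<Longrightarrow> g u \<in> {0..1}" "\<And>u. u \<in> space M \<Longrightarrow> h u \<in> {0..1}" for g h :: "'a \<Rightarrow> real"
  proof (intro integrable_const_bound[where B=1] AE_I2)
    fix u assume "u \<in> space M"
    with that(3,4)[of u] show "norm ((g u - h u)\<^sup>2) \<le> 1"
      by (simp add: abs_square_le_1 abs_le_iff)
  qed measurable
  note ints = int[OF meas(1,3) unit(1,3)] int[OF meas(3,2) unit(3,2)] int[OF meas(1,2) unit(1,2)]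
    int[OF meas(4,1) unit(4,1)] int[OF meas(4,2) unit(4,2)]
  \<comment> \<open>\<open>c\<close> is the point with parameter \<open>t\<close> on the straight
    segment from \<open>a\<close> to \<open>b\<close>. The identity \<open>c_sq\<close> is Stewart's
    theorem at each point \<open>u\<close>; it is used once with \<open>f\<close> and once with
    \<open>m\<close> in place of \<open>g\<close>.\<close>
  define c where "c u = (1 - t) * a u + t * b u" for u
  have c_sq: "(g u - c u)\<^sup>2 = (1 - t) * (g u - a u)\<^sup>2 + t * (g u - b u)\<^sup>2 - t * (1 - t) * (a u - b u)\<^sup>2"
    for g :: "'a \<Rightarrow> real" and u
    unfolding c_def by (simp add: power2_eq_square algebra_simps)
  have "(\<lambda>u. (f u - c u)\<^sup>2) = (\<lambda>u. (1 - t) * (a u - f u)\<^sup>2 + t * (f u - b u)\<^sup>2 - t * (1 - t) * (a u - b u)\<^sup>2)"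
    by (simp add: c_sq power2_commute[of "f _" "a _"])
  then have fc: "integrable M (\<lambda>u. (f u - c u)\<^sup>2)"
    and "(\<integral>u. (f u - c u)\<^sup>2 \<partial>M) = (1 - t) * (\<integral>u. (a u - f u)\<^sup>2 \<partial>M) + t * (\<integral>u. (f u - b u)\<^sup>2 \<partial>M)
      - t * (1 - t) * (\<integral>u. (a u - b u)\<^sup>2 \<partial>M)"
    using ints by simp_all
  \<comment> \<open>After inserting \<open>af\<close> and \<open>fb\<close>, the coefficient of the
    integral of \<open>(a u - b u)\<close> squared is
    \<open>t * (1 - t) * (t + (1 - t) - 1)\<close>, which vanishes.\<close>
  then have "(\<integral>u. (f u - c u)\<^sup>2 \<partial>M) = 0"
    unfolding af fb by algebra
  then have "AE u in M. f u = c u"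
    using integral_nonneg_eq_0_iff_AE[OF fc] by simp
  then have "(\<integral>u. (m u - f u)\<^sup>2 \<partial>M) = (\<integral>u. (m u - c u)\<^sup>2 \<partial>M)"
    by (intro integral_cong_AE) (auto simp: c_def)
  also have "\<dots> = (\<integral>u. (1 - t) * (m u - a u)\<^sup>2 + t * (m u - b u)\<^sup>2 - t * (1 - t) * (a u - b u)\<^sup>2 \<partial>M)"
    by (simp only: c_sq)
  also have "\<dots> = (1 - t) * (\<integral>u. (m u - a u)\<^sup>2 \<partial>M) + t * (\<integral>u. (m u - b u)\<^sup>2 \<partial>M)
      - t * (1 - t) * (\<integral>u. (a u - b u)\<^sup>2 \<partial>M)"
    using ints by simp
  finally show ?thesis .
qed

text \<open>Squaring the two distance conditions gives exactly the hypotheses \<open>af\<close> and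
  \<open>fb\<close> of \<open>stewart_L2\<close> for the quantile functions, with that of \<mu> as
  \<open>m\<close>.\<close>

lemma dW_stewart:
  assumes P0: "\<mu> \<in> P0" "\<nu> \<in> P0" "\<eta> \<in> P0" "x \<in> P0"
    and "dW \<nu> x = t * dW \<nu> \<eta>" "dW x \<eta> = (1 - t) * dW \<nu> \<eta>"
  shows "(dW \<mu> x)\<^sup>2 = (1 - t) * (dW \<mu> \<nu>)\<^sup>2 + t * (dW \<mu> \<eta>)\<^sup>2 - t * (1 - t) * (dW \<nu> \<eta>)\<^sup>2"
proof -
  have "(dW \<nu> x)\<^sup>2 = t\<^sup>2 * (dW \<nu> \<eta>)\<^sup>2" "(dW x \<eta>)\<^sup>2 = (1 - t)\<^sup>2 * (dW \<nu> \<eta>)\<^sup>2"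
    using assms(5,6) by (simp_all add: power_mult_distrib)
  then show ?thesis
    unfolding dW_quantile(1)[OF P0(1,4)] dW_quantile(1)[OF P0(2,4)] dW_quantile(1)[OF P0(4,3)]
      dW_quantile(1)[OF P0(1,2)] dW_quantile(1)[OF P0(1,3)] dW_quantile(1)[OF P0(2,3)]
    by (intro stewart_L2 quantile_measurable quantile_unit P0 prob_space_unit_lebesgue) simp_all
qed

text \<open>The Euclidean counterpart of \<open>dW_stewart\<close> with the same coefficients, so
  equal side lengths and equal \<open>t\<close> give equal values. It follows by expanding inner
  products.\<close>

lemma dist_stewart:
  fixes p q r :: "'a::real_inner"
  assumes "x = (1 - t) *\<^sub>R q + t *\<^sub>R r"
  shows "(dist p x)\<^sup>2 = (1 - t) * (dist p q)\<^sup>2 + t * (dist p r)\<^sup>2 - t * (1 - t) * (dist q r)\<^sup>2"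
  unfolding assms dist_norm power2_norm_eq_inner
  by (simp add: inner_simps inner_commute algebra_simps)

theorem proposition5p3:
  fixes \<mu> \<nu> \<eta> x :: "real measure"
    and \<gamma>\<mu>\<nu> \<gamma>\<mu>\<eta> \<gamma>\<nu>\<eta> :: "real \<Rightarrow> real measure"
    and p q r x' :: "real ^ 2"
  assumes "geodesic_triangle P0 dW \<mu> \<nu> \<eta> \<gamma>\<mu>\<nu> \<gamma>\<mu>\<eta> \<gamma>\<nu>\<eta>"
    and "dist p q = dW \<mu> \<nu>"
    and "dist p r = dW \<mu> \<eta>"
    and "dist q r = dW \<nu> \<eta>"
    and "x \<in> \<gamma>\<nu>\<eta> ` {0..1}"
    and "x' \<in> closed_segment q r"
    and "dist q x' = dW \<nu> x"
    and "dist x' r = dW x \<eta>"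
  shows "dW \<mu> x = dist p x'"
proof -
  have P0: "\<mu> \<in> P0" "\<nu> \<in> P0" "\<eta> \<in> P0" and geo: "geodesic_between P0 dW \<gamma>\<nu>\<eta> \<nu> \<eta>"
    using assms(1) by (simp_all add: geodesic_triangle_def)
  have "x \<in> P0"
    using geo assms(5) by (auto simp: geodesic_between_def)
  \<comment> \<open>The parameter is read off from the comparison point, and the distance hypotheses
    carry it over to \<open>x\<close>; this also covers the degenerate case
    \<open>q = r\<close>.\<close>
  obtain t where t: "0 \<le> t" "t \<le> 1" and x': "x' = (1 - t) *\<^sub>R q + t *\<^sub>R r"
    using assms(6) by (auto simp: closed_segment_def)
  have "q - x' = t *\<^sub>R (q - r)" "x' - r = (1 - t) *\<^sub>R (q - r)"
    by (simp_all add: x' algebra_simps)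
  \<comment> \<open>Since \<open>t\<close> lies between 0 and 1, both scalars leave the norm without
    absolute values.\<close>
  then have "dW \<nu> x = t * dW \<nu> \<eta>" "dW x \<eta> = (1 - t) * dW \<nu> \<eta>"
    using t by (simp_all flip: assms(4,7,8) add: dist_norm)
  then have "(dW \<mu> x)\<^sup>2 = (dist p x')\<^sup>2"
    using dW_stewart[OF P0 \<open>x \<in> P0\<close>] dist_stewart[OF x', of p] by (simp add: assms(2,3,4))
  then show ?thesis
    using dW_quantile(2)[OF P0(1) \<open>x \<in> P0\<close>] by simp
qed

end
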